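(* Let $n\ge 2$, let $\lambda_1,\dots,\lambda_n$ be non-zero complex numbers and let $H^n_k(z_1,\dots,z_n)=\lambda_1z_1^k+\lambda_2z_2^k+\dots+\lambda_nz_n^k$. If $k>2$, then the foliation $\mathcal{H}_k$ of $\mathbb{C}^n$ defined by the fibres of $H^n_k$ has a Morse structure compatible with the quadratic form $Q=|z_1|^2+|z_2|^2+\dots+|z_n|^2$, and the corresponding polar variety $M(\mathcal{H}_k,Q)$ consists of a finite number of complex lines through the origin.
   Context: $k$ is an integer. $\mathcal{H}_k$ is the codimension one holomorphic foliation with an isolated singularity at $\mathbf{0}$ whose leaves, in $\mathbb{C}^n\setminus\{\mathbf{0}\}$, are the (connected components of the) fibres of $H^n_k$ with $\mathbf{0}$ removed. A foliation $\mathcal{F}$ has a Morse structure compatible with $Q$ if for each leaf $\mathcal{L}$ the restriction $Q|_{\mathcal{L}}$ is a Morse function on $\mathcal{L}$, i.e. all its critical points are non-degenerate. The polar variety $M(\mathcal{F},Q)$ is the union of $\{\mathbf{0}\}$ with the set of points $\mathbf{z}\ne\mathbf{0}$ at which the leaf of $\mathcal{F}$ through $\mathbf{z}$ is tangent to the level hypersurface (sphere) of $Q$ through $\mathbf{z}$, equivalently the set of critical points of the restrictions of $Q$ to the leaves, together with $\mathbf{0}$. *)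

theory Defs
  imports "HOL-Analysis.Analysis"
begin

definition diag_poly :: "nat \<Rightarrow> complex ^ 'n \<Rightarrow> complex ^ 'n \<Rightarrow> complex" where
  "diag_poly k lam z = (\<Sum>i\<in>UNIV. lam $ i * (z $ i) ^ k)"

definition quad_form :: "complex ^ 'n \<Rightarrow> real" where
  "quad_form z = (\<Sum>i\<in>UNIV. (cmod (z $ i))\<^sup>2)"

text \<open>A foliation of the complement of the origin is represented by its set of leaves.
  The origin is removed from a fibre before passing to connected components, so that
  different branches of the singular fibre meeting only at the origin are different leaves.\<close>

definition fibre_foliation :: "(complex ^ 'n \<Rightarrow> complex) \<Rightarrow> (complex ^ 'n) set set" where
  "fibre_foliation h = (\<Union>c. components ({z. h z = c} - {0}))"

text \<open>Meant for open \<open>W\<close>. Here \<open>*s\<close> is scalar multiplication by complex numbers, so the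
  Frechet derivative, which is only real linear by definition, is required to be complex linear.\<close>

definition holomorphic_map_on ::
    "(complex ^ 'n \<Rightarrow> complex ^ 'm) \<Rightarrow> (complex ^ 'n) set \<Rightarrow> bool" where
  "holomorphic_map_on f W \<longleftrightarrow>
     (\<forall>w\<in>W. \<exists>D. (f has_derivative D) (at w) \<and> Vector_Spaces.linear (*s) (*s) D)"

text \<open>A foliation chart centred at \<open>p\<close>: a biholomorphic map \<open>\<Phi>\<close> from a convex neighbourhood
  \<open>W\<close> of the origin onto a neighbourhood of \<open>p\<close> that carries slices \<open>w $ i = c\<close> to the plaques
  of \<open>L\<close>. Charts of \<open>L\<close> itself, of dimension \<open>n - 1\<close>, are the restrictions of \<open>\<Phi>\<close> to the slices;
  the one around \<open>p\<close> is the restriction to \<open>w $ i = 0\<close>. Leaves of a foliation need not be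
  embedded, so countably many plaques of the same leaf are allowed.\<close>

definition leaf_chart ::
    "(complex ^ 'n) set \<Rightarrow> complex ^ 'n \<Rightarrow> 'n \<Rightarrow> (complex ^ 'n) set
      \<Rightarrow> (complex ^ 'n \<Rightarrow> complex ^ 'n) \<Rightarrow> bool" where
  "leaf_chart L p i W \<Phi> \<longleftrightarrow>
     open W \<and> convex W \<and> 0 \<in> W \<and> \<Phi> 0 = p \<and>
     inj_on \<Phi> W \<and> open (\<Phi> ` W) \<and>
     holomorphic_map_on \<Phi> W \<and> holomorphic_map_on (inv_into W \<Phi>) (\<Phi> ` W) \<and>
     (\<exists>C. countable C \<and> 0 \<in> C \<and> L \<inter> \<Phi> ` W = \<Phi> ` {w \<in> W. w $ i \<in> C})"

definition complex_hypersurface :: "(complex ^ 'n) set \<Rightarrow> bool" where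
  "complex_hypersurface L \<longleftrightarrow> (\<forall>p\<in>L. \<exists>i W \<Phi>. leaf_chart L p i W \<Phi>)"

definition critical_in_chart ::
    "(complex ^ 'n \<Rightarrow> real) \<Rightarrow> 'n \<Rightarrow> (complex ^ 'n \<Rightarrow> complex ^ 'n) \<Rightarrow> bool" where
  "critical_in_chart f i \<Phi> \<longleftrightarrow>
     (\<exists>D. ((f \<circ> \<Phi>) has_derivative D) (at 0) \<and> (\<forall>v. v $ i = 0 \<longrightarrow> D v = 0))"

definition has_hessian ::
    "('a::real_normed_vector \<Rightarrow> real) \<Rightarrow> ('a \<Rightarrow> 'a \<Rightarrow> real) \<Rightarrow> 'a \<Rightarrow> bool" where
  "has_hessian g B x \<longleftrightarrow>
     (\<exists>g'. (\<forall>\<^sub>F y in nhds x. (g has_derivative g' y) (at y)) \<and>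
           (\<forall>u. ((\<lambda>y. g' y u) has_derivative B u) (at x)))"

definition nondegenerate_in_chart ::
    "(complex ^ 'n \<Rightarrow> real) \<Rightarrow> 'n \<Rightarrow> (complex ^ 'n \<Rightarrow> complex ^ 'n) \<Rightarrow> bool" where
  "nondegenerate_in_chart f i \<Phi> \<longleftrightarrow>
     (\<exists>B. has_hessian (f \<circ> \<Phi>) B 0 \<and>
          (\<forall>u. u $ i = 0 \<and> (\<forall>v. v $ i = 0 \<longrightarrow> B u v = 0) \<longrightarrow> u = 0))"

text \<open>For smooth \<open>f\<close>, being a critical point of the restriction of \<open>f\<close> to \<open>L\<close>, and the
  non-degeneracy of a critical point, do not depend on the chart.\<close>

definition critical_point_on ::
    "(complex ^ 'n) set \<Rightarrow> (complex ^ 'n \<Rightarrow> real) \<Rightarrow> complex ^ 'n \<Rightarrow> bool" where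
  "critical_point_on L f p \<longleftrightarrow>
     p \<in> L \<and> (\<exists>i W \<Phi>. leaf_chart L p i W \<Phi> \<and> critical_in_chart f i \<Phi>)"

definition nondegenerate_critical_point_on ::
    "(complex ^ 'n) set \<Rightarrow> (complex ^ 'n \<Rightarrow> real) \<Rightarrow> complex ^ 'n \<Rightarrow> bool" where
  "nondegenerate_critical_point_on L f p \<longleftrightarrow>
     p \<in> L \<and> (\<exists>i W \<Phi>. leaf_chart L p i W \<Phi> \<and>
        critical_in_chart f i \<Phi> \<and> nondegenerate_in_chart f i \<Phi>)"

text \<open>The first conjunct guarantees that every point of \<open>L\<close> has charts, without which the
  condition on critical points could hold vacuously.\<close>

definition morse_function_on ::
    "(complex ^ 'n) set \<Rightarrow> (complex ^ 'n \<Rightarrow> real) \<Rightarrow> bool" where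
  "morse_function_on L f \<longleftrightarrow>
     complex_hypersurface L \<and>
     (\<forall>p. critical_point_on L f p \<longrightarrow> nondegenerate_critical_point_on L f p)"

definition has_morse_structure ::
    "(complex ^ 'n) set set \<Rightarrow> (complex ^ 'n \<Rightarrow> real) \<Rightarrow> bool" where
  "has_morse_structure F f \<longleftrightarrow> (\<forall>L\<in>F. morse_function_on L f)"

text \<open>The (real) tangent space of an immersed submanifold, as the set of velocities of
  differentiable curves in it.\<close>

definition tangent_space :: "'a::real_normed_vector set \<Rightarrow> 'a \<Rightarrow> 'a set" where
  "tangent_space S p =
     {v. \<exists>\<gamma> e. e > (0::real) \<and> \<gamma> 0 = p \<and> (\<gamma> has_vector_derivative v) (at 0) \<and>
          (\<forall>t. \<bar>t\<bar> < e \<longrightarrow> \<gamma> t \<in> S \<and> \<gamma> differentiable (at t))}"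

definition polar_variety ::
    "(complex ^ 'n) set set \<Rightarrow> (complex ^ 'n \<Rightarrow> real) \<Rightarrow> (complex ^ 'n) set" where
  "polar_variety F f =
     {0} \<union> {z. z \<noteq> 0 \<and> (\<exists>L\<in>F. z \<in> L \<and> tangent_space L z \<subseteq> tangent_space {w. f w = f z} z)}"

definition complex_line_through_0 :: "(complex ^ 'n) set \<Rightarrow> bool" where
  "complex_line_through_0 l \<longleftrightarrow> vec.subspace l \<and> vec.dim l = 1"

end

theory Submission
  imports Defs
begin

text \<open>
  Let \<open>H = diag_poly k lam\<close>. The differential of \<open>H\<close> has the coefficients
  \<open>k * lam $ j * (z $ j) ^ (k - 1)\<close> and does not vanish away from the origin, so there the leaves
  are smooth and the tangent space of a leaf is the kernel of the differential
  (\<open>tangent_space_leaf\<close>). The tangent space of the sphere through \<open>z\<close> is the real orthogonal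
  complement of \<open>z\<close> (\<open>tangent_space_sphere\<close>). The kernel is a complex subspace, so it lies in this
  complement exactly if the form with coefficients \<open>cnj (z $ j)\<close> is a multiple of the differential,
  that is, if for some \<open>\<mu>\<close>
  \<open>cnj (z $ j) = \<mu> * (lam $ j * (z $ j) ^ (k - 1))\<close> for all \<open>j\<close>
  (\<open>critical_eq\<close>, \<open>critical_eq_iff_orthogonal\<close>). Both parts of the theorem rest on this equation.

  \<^emph>\<open>Polar variety.\<close> The equation is preserved by multiplication with complex numbers, as \<open>\<mu>\<close> can
  absorb the factors, so its solutions form lines. On each line some coordinate can be made 1.
  This determines \<open>\<mu>\<close>, and each other coordinate then satisfies an equation
  \<open>cnj x = c * x ^ (k - 1)\<close>, which has finitely many solutions since \<open>k > 2\<close>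
  (\<open>finite_conjugate_power_solutions\<close>, \<open>critical_set_finite_union_of_lines\<close>).

  \<^emph>\<open>Morse structure.\<close> Around a point \<open>p\<close> with \<open>p $ i \<noteq> 0\<close> a leaf is a graph over the coordinates
  other than \<open>i\<close>, with an explicit \<open>k\<close>-th root as its function (\<open>leaf_chart_chart\<close>). At a critical
  point, the Hessian of \<open>quad_form\<close> on the leaf is, for tangent vectors \<open>U\<close> and \<open>V\<close>, twice the real
  part of the sum of
  \<open>(cnj (U $ j) - (k - 1) * \<mu> * lam $ j * (p $ j) ^ (k - 2) * U $ j) * V $ j\<close>.
  The conjugate linear part comes from the form itself and the complex linear part from the curvature
  of the leaf; by the equation above, the coefficient of \<open>U $ j\<close> has the absolute value
  \<open>k - 1\<close> or 0. As \<open>k - 1 > 1\<close>, the two parts cannot balance each other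
  (\<open>nondegenerate_in_chart_chart\<close>).
\<close>

section \<open>Linear algebra over the complex coordinates\<close>

lemma sum_axis_expansion:
  fixes x :: "'a::comm_monoid_add ^ 'n"
  shows "(\<Sum>j\<in>UNIV. axis j (x $ j)) = x"
  by (simp add: vec_eq_iff axis_def)

lemma has_derivative_componentwiseI:
  fixes f :: "'a::real_normed_vector \<Rightarrow> complex ^ 'n"
  assumes "\<And>j. ((\<lambda>x. f x $ j) has_derivative (\<lambda>h. f' h $ j)) F"
  shows "(f has_derivative f') F"
proof -
  have ax: "bounded_linear (axis j :: complex \<Rightarrow> complex ^ 'n)" for j
    unfolding linear_conv_bounded_linear[symmetric]
    by (intro linearI) (simp_all add: vec_eq_iff axis_def)
  have "((\<lambda>x. \<Sum>j\<in>UNIV. axis j (f x $ j)) has_derivative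
         (\<lambda>h. \<Sum>j\<in>UNIV. axis j (f' h $ j))) F"
    by (intro has_derivative_sum bounded_linear.has_derivative[OF ax] assms)
  thus ?thesis by (simp only: sum_axis_expansion)
qed

lemma has_derivative_vec_nth:
  "((\<lambda>z :: complex ^ 'n. z $ j) has_derivative (\<lambda>u. u $ j)) F"
  by (rule bounded_linear.has_derivative[OF bounded_linear_vec_nth has_derivative_ident])

lemma inner_eq_Re_sum:
  fixes z u :: "complex ^ 'n"
  shows "z \<bullet> u = Re (\<Sum>j\<in>UNIV. cnj (z $ j) * u $ j)"
  by (simp add: inner_vec_def inner_complex_def)

lemma quad_form_eq_inner: "quad_form z = z \<bullet> z"
  by (simp add: quad_form_def inner_vec_def dot_square_norm)

text \<open>The kernel of the complex linear form with coefficients \<open>b\<close> is stable under multiplication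
  by complex numbers, so a complex linear form whose real part vanishes on it vanishes on it too,
  and is then a multiple of \<open>b\<close>. The vectors supported on the two coordinates \<open>i\<close> and \<open>j\<close> already
  show this.\<close>

lemma proportional_if_Re_vanishes_on_kernel:
  fixes a b :: "complex ^ 'n"
  assumes bi: "b $ i \<noteq> 0"
    and ker: "\<And>v. (\<Sum>j\<in>UNIV. b $ j * v $ j) = 0 \<Longrightarrow> Re (\<Sum>j\<in>UNIV. a $ j * v $ j) = 0"
  shows "a $ j = a $ i / b $ i * b $ j"
proof (cases "j = i")
  case True
  thus ?thesis using bi by simp
next
  case False
  define v where "v c = axis j c - axis i (c * b $ j / b $ i)" for c
  have pair: "(\<Sum>l\<in>UNIV. d $ l * v c $ l) = c * (d $ j - d $ i / b $ i * b $ j)"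
    for c and d :: "complex ^ 'n"
  proof -
    have "(\<Sum>l\<in>UNIV. d $ l * v c $ l)
        = (\<Sum>l\<in>UNIV. (if l = j then d $ j * c else 0) - (if l = i then d $ i * (c * b $ j / b $ i) else 0))"
      by (intro sum.cong) (auto simp: v_def axis_def algebra_simps)
    also have "\<dots> = d $ j * c - d $ i * (c * b $ j / b $ i)"
      by (simp only: sum_subtractf) simp
    finally show ?thesis by (simp add: algebra_simps)
  qed
  define d where "d = a $ j - a $ i / b $ i * b $ j"
  \<comment> \<open>The factor \<open>cnj d\<close> turns the value \<open>d\<close> of the form into \<open>cnj d * d\<close>, which is seen by
    its real part.\<close>
  have "(\<Sum>l\<in>UNIV. b $ l * v (cnj d) $ l) = 0"
    using bi by (simp add: pair)
  from ker[OF this] have "Re (cnj d * d) = 0"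
    by (simp add: pair d_def)
  hence "d = 0"
    by (simp add: complex_eq_iff sum_power2_eq_zero_iff flip: power2_eq_square)
  thus ?thesis by (simp add: d_def)
qed

section \<open>The differential of the polynomial and the critical equation\<close>

text \<open>The differential of \<open>diag_poly k lam\<close> at \<open>p\<close> without its factor \<open>k\<close>, which does not affect
  the kernel.\<close>

definition diag_form :: "nat \<Rightarrow> complex ^ 'n \<Rightarrow> complex ^ 'n \<Rightarrow> complex ^ 'n \<Rightarrow> complex" where
  "diag_form k lam p u = (\<Sum>j\<in>UNIV. lam $ j * (p $ j) ^ (k - 1) * u $ j)"

lemma has_derivative_diag_poly:
  "(diag_poly k lam has_derivative (\<lambda>u. of_nat k * diag_form k lam p u)) (at p)"
proof -
  have "((\<lambda>z. \<Sum>j\<in>UNIV. lam $ j * (z $ j) ^ k) has_derivative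
         (\<lambda>u. \<Sum>j\<in>UNIV. lam $ j * (of_nat k * u $ j * (p $ j) ^ (k - 1)))) (at p)"
    by (intro has_derivative_sum has_derivative_mult_right has_derivative_power
        has_derivative_vec_nth)
  thus ?thesis
    by (simp add: diag_poly_def[abs_def] diag_form_def sum_distrib_left mult_ac)
qed

lemma has_derivative_quad_form:
  "(quad_form has_derivative (\<lambda>u. 2 * (p \<bullet> u))) (at p)"
proof -
  have "((\<lambda>z. z \<bullet> z) has_derivative (\<lambda>u. p \<bullet> u + u \<bullet> p)) (at p)"
    by (intro has_derivative_inner has_derivative_ident)
  thus ?thesis
    by (simp add: quad_form_eq_inner[abs_def] inner_commute)
qed

lemma diag_form_scale: "diag_form k lam p (c *s u) = c * diag_form k lam p u"
  by (simp add: diag_form_def sum_distrib_left mult_ac)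

text \<open>The Lagrange multiplier equation for \<open>quad_form\<close> on a fibre of \<open>diag_poly k lam\<close>: the
  real gradient of \<open>quad_form\<close> at \<open>p\<close> corresponds to the complex linear form with coefficients
  \<open>cnj (p $ j)\<close>, and this form has to be a complex multiple of the differential.\<close>

definition critical_eq :: "nat \<Rightarrow> complex ^ 'n \<Rightarrow> complex ^ 'n \<Rightarrow> bool" where
  "critical_eq k lam p \<longleftrightarrow> (\<exists>\<mu>. \<forall>j. cnj (p $ j) = \<mu> * (lam $ j * (p $ j) ^ (k - 1)))"

lemma critical_eq_iff_orthogonal:
  fixes lam :: "complex ^ 'n"
  assumes lam: "\<And>i. lam $ i \<noteq> 0" and p: "p \<noteq> 0"
  shows "critical_eq k lam p \<longleftrightarrow> (\<forall>u. diag_form k lam p u = 0 \<longrightarrow> p \<bullet> u = 0)"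
proof
  assume "critical_eq k lam p"
  then obtain \<mu> where \<mu>: "cnj (p $ j) = \<mu> * (lam $ j * (p $ j) ^ (k - 1))" for j
    by (auto simp: critical_eq_def)
  have "p \<bullet> u = Re (\<mu> * diag_form k lam p u)" for u
    unfolding inner_eq_Re_sum \<mu> by (simp add: diag_form_def sum_distrib_left mult_ac)
  thus "\<forall>u. diag_form k lam p u = 0 \<longrightarrow> p \<bullet> u = 0" by simp
next
  assume *: "\<forall>u. diag_form k lam p u = 0 \<longrightarrow> p \<bullet> u = 0"
  obtain i where i: "p $ i \<noteq> 0" using p by (auto simp: vec_eq_iff)
  define b where "b = (\<chi> j. lam $ j * (p $ j) ^ (k - 1))"
  define a where "a = (\<chi> j. cnj (p $ j))"
  have proportional: "a $ j = a $ i / b $ i * b $ j" for j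
  proof (rule proportional_if_Re_vanishes_on_kernel)
    show "b $ i \<noteq> 0" using i lam by (simp add: b_def)
    show "Re (\<Sum>j\<in>UNIV. a $ j * v $ j) = 0" if "(\<Sum>j\<in>UNIV. b $ j * v $ j) = 0" for v
      using that * by (auto simp: a_def b_def diag_form_def inner_eq_Re_sum)
  qed
  have "cnj (p $ j) = a $ i / b $ i * (lam $ j * (p $ j) ^ (k - 1))" for j
    using proportional[of j] by (simp only: a_def b_def vec_lambda_beta)
  thus "critical_eq k lam p"
    unfolding critical_eq_def by blast
qed

section \<open>The critical points form finitely many lines\<close>

text \<open>Conjugating the equation and substituting it into itself removes the conjugation: \<open>x\<close> is a
  root of \<open>x - C * x ^ m\<close> with \<open>m = (k - 1)\<^sup>2 > 1\<close>, which is a non-zero polynomial. For \<open>k = 2\<close>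
  the equation can hold on a whole real line.\<close>

lemma finite_conjugate_power_solutions:
  assumes "c \<noteq> 0" and "k > 2"
  shows "finite {x. cnj x = c * x ^ (k - 1)}"
proof -
  define m where "m = (k - 1) * (k - 1)"
  define C where "C = cnj c * c ^ (k - 1)"
  have m: "m > 1" using assms(2) by (simp add: m_def one_less_mult)
  define P where "P = [:0, 1:] - monom C m"
  have "coeff P 1 = 1" using m by (simp add: P_def)
  hence "P \<noteq> 0" by auto
  hence "finite {x. poly P x = 0}" by (rule poly_roots_finite)
  moreover have "{x. cnj x = c * x ^ (k - 1)} \<subseteq> {x. poly P x = 0}"
  proof safe
    fix x assume x: "cnj x = c * x ^ (k - 1)"
    have "x = cnj (cnj x)" by simp
    also have "\<dots> = cnj c * (cnj x) ^ (k - 1)" by (simp only: x complex_cnj_mult complex_cnj_power)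
    also have "\<dots> = C * x ^ m" unfolding x
      by (simp add: C_def m_def power_mult power_mult_distrib)
    finally show "poly P x = 0" by (simp add: P_def poly_monom)
  qed
  ultimately show ?thesis by (rule finite_subset[rotated])
qed

lemma critical_eq_scale:
  assumes "critical_eq k lam p" and "c \<noteq> 0"
  shows "critical_eq k lam (c *s p)"
proof -
  from assms(1) obtain \<mu> where \<mu>: "cnj (p $ j) = \<mu> * (lam $ j * (p $ j) ^ (k - 1))" for j
    by (auto simp: critical_eq_def)
  show ?thesis unfolding critical_eq_def
    using assms(2)
    by (intro exI[of _ "\<mu> * cnj c / c ^ (k - 1)"]) (simp add: \<mu> power_mult_distrib)
qed

lemma critical_eq_axis: "k > 1 \<Longrightarrow> lam $ i \<noteq> 0 \<Longrightarrow> critical_eq k lam (axis i 1)"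
  unfolding critical_eq_def by (intro exI[of _ "1 / lam $ i"]) (simp add: axis_def)

lemma finite_vec_if_components_finite:
  fixes B :: "'n::finite \<Rightarrow> 'a set"
  assumes "\<And>j. finite (B j)"
  shows "finite {z :: 'a ^ 'n. \<forall>j. z $ j \<in> B j}"
proof -
  have "{z :: 'a ^ 'n. \<forall>j. z $ j \<in> B j} \<subseteq> vec_lambda ` Pi\<^sub>E UNIV B"
  proof
    fix z assume "z \<in> {z :: 'a ^ 'n. \<forall>j. z $ j \<in> B j}"
    hence "vec_nth z \<in> Pi\<^sub>E UNIV B" by auto
    hence "vec_lambda (vec_nth z) \<in> vec_lambda ` Pi\<^sub>E UNIV B" by (rule imageI)
    thus "z \<in> vec_lambda ` Pi\<^sub>E UNIV B" by simp
  qed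
  moreover have "finite (Pi\<^sub>E UNIV B)"
    using assms by (simp add: finite_PiE)
  ultimately show ?thesis
    by (meson finite_imageI finite_subset)
qed

text \<open>By homogeneity every line of solutions contains a point with some coordinate \<open>i\<close> equal to 1.
  There the multiplier must be \<open>1 / lam $ i\<close>, so that the other coordinates satisfy
  equations in one variable that have finitely many solutions. The axes are among the lines,
  which is why the union contains the origin.\<close>

lemma critical_set_finite_union_of_lines:
  fixes lam :: "complex ^ 'n"
  assumes lam: "\<And>i. lam $ i \<noteq> 0" and k: "k > 2"
  shows "\<exists>A. finite A \<and> (\<forall>l\<in>A. complex_line_through_0 l) \<and>
             {0} \<union> {z. z \<noteq> 0 \<and> critical_eq k lam z} = \<Union>A"
proof -
  define N where "N = {z. critical_eq k lam z \<and> (\<exists>i. z $ i = 1)}"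
  have "N \<subseteq> (\<Union>i. {z. \<forall>j. z $ j \<in> {x. cnj x = lam $ j / lam $ i * x ^ (k - 1)}})"
  proof
    fix z assume "z \<in> N"
    then obtain \<mu> i where \<mu>: "\<And>j. cnj (z $ j) = \<mu> * (lam $ j * (z $ j) ^ (k - 1))"
      and i: "z $ i = 1"
      by (auto simp: N_def critical_eq_def)
    have "\<mu> = 1 / lam $ i" using \<mu>[of i] i lam by (simp add: field_simps)
    hence "\<forall>j. cnj (z $ j) = lam $ j / lam $ i * (z $ j) ^ (k - 1)"
      using \<mu> by simp
    thus "z \<in> (\<Union>i. {z. \<forall>j. z $ j \<in> {x. cnj x = lam $ j / lam $ i * x ^ (k - 1)}})"
      by blast
  qed
  moreover have "finite (\<Union>i. {z. \<forall>j. z $ j \<in> {x. cnj x = lam $ j / lam $ i * x ^ (k - 1)}})"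
    using lam k
    by (intro finite_UN_I finite_vec_if_components_finite finite_conjugate_power_solutions) auto
  ultimately have fin: "finite N" by (rule finite_subset)
  define A where "A = (\<lambda>z. vec.span {z}) ` N"
  have N0: "z \<noteq> 0" if "z \<in> N" for z using that by (auto simp: N_def)
  have "\<Union>A = {0} \<union> {z. z \<noteq> 0 \<and> critical_eq k lam z}"
  proof (intro equalityI subsetI)
    fix z assume "z \<in> \<Union>A"
    then obtain w c where "w \<in> N" "z = c *s w"
      by (auto simp: A_def vec.span_singleton)
    thus "z \<in> {0} \<union> {z. z \<noteq> 0 \<and> critical_eq k lam z}"
      by (cases "c = 0") (auto simp: N_def intro: critical_eq_scale)
  next
    fix z assume z: "z \<in> {0} \<union> {z. z \<noteq> 0 \<and> critical_eq k lam z}"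
    show "z \<in> \<Union>A"
    proof (cases "z = 0")
      case True
      have "axis undefined 1 \<in> N" unfolding N_def
        using critical_eq_axis[of k lam undefined] lam k by (auto intro: exI[of _ undefined])
      thus ?thesis using True by (auto simp: A_def vec.span_zero)
    next
      case False
      then obtain i where i: "z $ i \<noteq> 0" by (auto simp: vec_eq_iff)
      define w where "w = (1 / z $ i) *s z"
      have "w \<in> N" unfolding N_def w_def
        using critical_eq_scale[of k lam z "1 / z $ i"] z False i by (auto intro: exI[of _ i])
      moreover have "z = z $ i *s w" using i by (simp add: w_def)
      hence "z \<in> vec.span {w}" unfolding vec.span_singleton by (rule range_eqI)
      ultimately show ?thesis by (auto simp: A_def)
    qed
  qed
  moreover have "complex_line_through_0 l" if "l \<in> A" for l
    using that N0 by (auto simp: A_def complex_line_through_0_def vec.subspace_span)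
  moreover have "finite A" using fin by (simp add: A_def)
  ultimately show ?thesis by (intro exI[of _ A]) simp
qed

section \<open>Tangent spaces\<close>

text \<open>The image under the chart of a straight segment in the slice through the centre is a curve
  in the leaf.\<close>

lemma leaf_chart_derivative_in_tangent_space:
  assumes ch: "leaf_chart L p i W \<Phi>"
    and T: "(\<Phi> has_derivative T) (at 0)" and u: "u $ i = 0"
  shows "T u \<in> tangent_space L p"
proof -
  obtain C where W: "open W" "0 \<in> W" "\<Phi> 0 = p" and hol: "holomorphic_map_on \<Phi> W"
    and C: "0 \<in> C" "L \<inter> \<Phi> ` W = \<Phi> ` {w \<in> W. w $ i \<in> C}"
    using ch unfolding leaf_chart_def by blast
  have "open ((\<lambda>t :: real. t *\<^sub>R u) -` W)"
    by (intro continuous_open_vimage W(1) continuous_intros)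
  moreover have "0 \<in> (\<lambda>t :: real. t *\<^sub>R u) -` W" using W(2) by simp
  ultimately obtain e where e: "e > 0" "ball 0 e \<subseteq> (\<lambda>t :: real. t *\<^sub>R u) -` W"
    using open_contains_ball by blast
  have inW: "t *\<^sub>R u \<in> W" if "\<bar>t\<bar> < e" for t
    using e(2) that by (auto simp: subset_iff dist_real_def)
  have line: "((\<lambda>t :: real. t *\<^sub>R u) has_derivative (\<lambda>s. s *\<^sub>R u)) (at t)" for t
    by (intro has_derivative_scaleR_left has_derivative_ident)
  have inL: "\<Phi> (t *\<^sub>R u) \<in> L" if "\<bar>t\<bar> < e" for t
  proof -
    have "t *\<^sub>R u \<in> {w \<in> W. w $ i \<in> C}" using inW[OF that] u C(1) by simp
    thus ?thesis using C(2) by blast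
  qed
  have diff: "(\<lambda>t. \<Phi> (t *\<^sub>R u)) differentiable (at t)" if t: "\<bar>t\<bar> < e" for t
  proof -
    obtain D where "(\<Phi> has_derivative D) (at (t *\<^sub>R u))"
      using hol inW[OF t] by (auto simp: holomorphic_map_on_def)
    from has_derivative_compose[OF line this] show ?thesis
      by (rule differentiableI)
  qed
  interpret T: bounded_linear T using T by (rule has_derivative_bounded_linear)
  have "((\<lambda>t. \<Phi> (t *\<^sub>R u)) has_derivative (\<lambda>s. T (s *\<^sub>R u))) (at 0)"
    by (rule has_derivative_compose[OF line]) (use T in simp)
  hence "((\<lambda>t. \<Phi> (t *\<^sub>R u)) has_vector_derivative T u) (at 0)"
    by (simp add: has_vector_derivative_def T.scaleR)
  thus ?thesis unfolding tangent_space_def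
    using e(1) inL diff W(3) by (intro CollectI exI[of _ "\<lambda>t. \<Phi> (t *\<^sub>R u)"] exI[of _ e]) auto
qed

lemma derivative_vanishes_on_tangent_space:
  fixes h :: "'a::real_normed_vector \<Rightarrow> 'b::real_normed_vector"
  assumes h: "(h has_derivative D) (at p)"
    and const: "\<And>z. z \<in> S \<Longrightarrow> h z = c" and v: "v \<in> tangent_space S p"
  shows "D v = 0"
proof -
  obtain \<gamma> e where e: "e > (0::real)" and p: "\<gamma> 0 = p"
    and \<gamma>: "(\<gamma> has_vector_derivative v) (at 0)" and inS: "\<And>t. \<bar>t\<bar> < e \<Longrightarrow> \<gamma> t \<in> S"
    using v unfolding tangent_space_def by blast
  have "((\<lambda>t. h (\<gamma> t)) has_derivative (\<lambda>t. D (t *\<^sub>R v))) (at 0)"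
    by (rule has_derivative_compose[OF \<gamma>[unfolded has_vector_derivative_def]])
       (use h p in simp)
  moreover have "((\<lambda>t. h (\<gamma> t)) has_derivative (\<lambda>t. 0)) (at 0)"
    by (rule has_derivative_transform_within_open[OF has_derivative_const[of c], where s = "ball 0 e"])
       (use e const inS in \<open>auto simp: dist_real_def\<close>)
  ultimately have "(\<lambda>t. D (t *\<^sub>R v)) = (\<lambda>t. 0)" by (rule has_derivative_unique)
  from fun_cong[OF this, of 1] show ?thesis by simp
qed

lemma tangent_space_fibre_subset:
  assumes "L \<subseteq> {z. diag_poly k lam z = c}" and "k > 0" and "v \<in> tangent_space L p"
  shows "diag_form k lam p v = 0"
proof -
  have "of_nat k * diag_form k lam p v = 0"
    by (rule derivative_vanishes_on_tangent_space[OF has_derivative_diag_poly _ assms(3), of _ _ c])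
       (use assms(1) in auto)
  thus ?thesis using assms(2) by simp
qed

lemma tangent_space_sphere:
  fixes z :: "complex ^ 'n"
  assumes z: "z \<noteq> 0"
  shows "tangent_space {w. quad_form w = quad_form z} z = {v. z \<bullet> v = 0}"
proof (intro equalityI subsetI)
  fix v assume v: "v \<in> tangent_space {w. quad_form w = quad_form z} z"
  have "2 * (z \<bullet> v) = 0"
    by (rule derivative_vanishes_on_tangent_space[OF has_derivative_quad_form _ v,
          of "quad_form z"]) simp
  thus "v \<in> {v. z \<bullet> v = 0}" by simp
next
  fix v assume "v \<in> {v. z \<bullet> v = 0}"
  hence zv: "z \<bullet> v = 0" by simp
  show "v \<in> tangent_space {w. quad_form w = quad_form z} z"
  proof (cases "v = 0")
    case True
    have "((\<lambda>t :: real. z) has_vector_derivative 0) (at 0)" by simp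
    thus ?thesis unfolding tangent_space_def
      using True by (intro CollectI exI[of _ "\<lambda>t. z"] exI[of _ 1]) auto
  next
    case False
    \<comment> \<open>The great circle through \<open>z\<close> in the direction \<open>v\<close>, run through with angular speed \<open>a\<close>.\<close>
    define a where "a = norm v / norm z"
    have a: "a > 0" using False z by (simp add: a_def)
    define \<gamma> where "\<gamma> t = cos (a * t) *\<^sub>R z + (sin (a * t) / a) *\<^sub>R v" for t
    have deriv: "(\<gamma> has_vector_derivative
        (- sin (a * t) * a) *\<^sub>R z + cos (a * t) *\<^sub>R v) (at t)" for t
      unfolding \<gamma>_def[abs_def] using a
      by (auto intro!: derivative_eq_intros simp: field_simps)
    have "quad_form (\<gamma> t) = quad_form z" for t
    proof -
      have "v \<bullet> v = a\<^sup>2 * (z \<bullet> z)"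
        using z by (simp add: a_def power_divide dot_square_norm)
      hence "quad_form (\<gamma> t) = (z \<bullet> z) * ((cos (a * t))\<^sup>2 + (sin (a * t))\<^sup>2)"
        using a zv unfolding quad_form_eq_inner \<gamma>_def distrib_left
        by (simp add: inner_add_left inner_add_right inner_commute[of v z] power2_eq_square)
      thus ?thesis by (simp add: quad_form_eq_inner)
    qed
    moreover have "\<gamma> 0 = z" by (simp add: \<gamma>_def)
    moreover have "(\<gamma> has_vector_derivative v) (at 0)" using deriv[of 0] by simp
    moreover have "\<gamma> differentiable (at t)" for t
      using deriv[of t] by (auto simp: has_vector_derivative_def intro: differentiableI)
    ultimately show ?thesis unfolding tangent_space_def
      by (intro CollectI exI[of _ \<gamma>] exI[of _ 1]) auto
  qed
qed

text \<open>Criticality in an arbitrary chart gives the multiplier equation because the derivative \<open>T\<close>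
  of the chart maps the slice directions onto the whole kernel of the differential of the
  polynomial. It maps them into the kernel since their images are tangent to the leaf. So
  the differential composed with \<open>T\<close> depends only on the coordinate \<open>v $ i\<close>, and it is not
  zero as \<open>T\<close> is surjective; hence it vanishes only on slice directions.\<close>

lemma critical_eq_if_critical_in_chart:
  fixes lam :: "complex ^ 'n"
  assumes lam: "\<And>i. lam $ i \<noteq> 0" and k: "k > 0"
    and L: "L \<subseteq> {z. diag_poly k lam z = c} - {0}"
    and ch: "leaf_chart L p i W \<Phi>" and crit: "critical_in_chart quad_form i \<Phi>" and pL: "p \<in> L"
  shows "critical_eq k lam p"
proof -
  have p: "p \<noteq> 0" using L pL by auto
  have W: "open W" "0 \<in> W" "\<Phi> 0 = p" "inj_on \<Phi> W" "open (\<Phi> ` W)"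
    and hol: "holomorphic_map_on \<Phi> W" "holomorphic_map_on (inv_into W \<Phi>) (\<Phi> ` W)"
    using ch unfolding leaf_chart_def by blast+
  obtain T where T: "(\<Phi> has_derivative T) (at 0)" and lin: "Vector_Spaces.linear (*s) (*s) T"
    using hol(1) W(2) unfolding holomorphic_map_on_def by blast
  have pW: "p \<in> \<Phi> ` W" using W by blast
  then obtain S where S: "(inv_into W \<Phi> has_derivative S) (at p)"
    using hol(2) unfolding holomorphic_map_on_def by blast
  have inv0: "inv_into W \<Phi> p = 0" using W inv_into_f_f by metis
  have "((\<lambda>z. \<Phi> (inv_into W \<Phi> z)) has_derivative (\<lambda>u. T (S u))) (at p)"
    by (rule has_derivative_compose[OF S]) (use T inv0 in simp)
  moreover have "((\<lambda>z. \<Phi> (inv_into W \<Phi> z)) has_derivative (\<lambda>u. u)) (at p)"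
    by (rule has_derivative_transform_within_open[OF has_derivative_ident W(5) pW])
       (simp add: f_inv_into_f)
  ultimately have "(\<lambda>u. T (S u)) = (\<lambda>u. u)" by (rule has_derivative_unique)
  hence TS: "T (S u) = u" for u by (rule fun_cong)
  have slice: "diag_form k lam p (T v) = 0" if "v $ i = 0" for v
    by (rule tangent_space_fibre_subset[where L = L and c = c])
       (use L k leaf_chart_derivative_in_tangent_space[OF ch T that] in auto)
  define e :: "complex ^ 'n" where "e = axis i 1"
  have split: "diag_form k lam p (T v) = v $ i * diag_form k lam p (T e)" for v
  proof -
    define v' where "v' = v - v $ i *s e"
    have "T v = v $ i *s T e + T v'"
      using lin unfolding v'_def Vector_Spaces.linear_iff
      by (metis add.commute diff_add_cancel)
    moreover have "diag_form k lam p (T v') = 0"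
      by (rule slice) (simp add: v'_def e_def)
    ultimately show ?thesis
      by (simp add: diag_form_def ring_distribs sum.distrib sum_distrib_left mult_ac)
  qed
  obtain j where j: "p $ j \<noteq> 0" using p by (auto simp: vec_eq_iff)
  have "diag_form k lam p (axis j 1) = lam $ j * p $ j ^ (k - 1)"
    by (simp add: diag_form_def axis_def if_distrib cong: if_cong)
  hence Te: "diag_form k lam p (T e) \<noteq> 0"
    using split[of "S (axis j 1)"] j lam TS by auto
  obtain D where D: "((quad_form \<circ> \<Phi>) has_derivative D) (at 0)"
    and D0: "\<And>v. v $ i = 0 \<Longrightarrow> D v = 0"
    using crit unfolding critical_in_chart_def by blast
  have "((\<lambda>w. quad_form (\<Phi> w)) has_derivative (\<lambda>u. 2 * (p \<bullet> T u))) (at 0)"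
    by (rule has_derivative_compose[OF T]) (use has_derivative_quad_form W(3) in simp)
  hence DT: "D v = 2 * (p \<bullet> T v)" for v
    using has_derivative_unique[OF D] by (simp add: o_def)
  have "p \<bullet> u = 0" if "diag_form k lam p u = 0" for u
  proof -
    have "S u $ i = 0" using split[of "S u"] that Te TS by simp
    from D0[OF this] show ?thesis by (simp add: DT TS)
  qed
  thus ?thesis using critical_eq_iff_orthogonal[of lam p k, OF lam p] by blast
qed

section \<open>An explicit chart of a fibre\<close>

lemma diag_poly_split:
  "diag_poly k lam z = lam $ i * (z $ i) ^ k + (\<Sum>j\<in>-{i}. lam $ j * (z $ j) ^ k)"
  unfolding diag_poly_def Compl_eq_Diff_UNIV by (rule sum.remove) auto

lemma diag_form_split:
  "diag_form k lam p u = lam $ i * (p $ i) ^ (k - 1) * u $ i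
     + (\<Sum>j\<in>-{i}. lam $ j * (p $ j) ^ (k - 1) * u $ j)"
  unfolding diag_form_def Compl_eq_Diff_UNIV by (rule sum.remove) auto

lemma has_derivative_affine_power:
  "((\<lambda>w :: complex ^ 'n. c * (a + w $ j) ^ m) has_derivative
    (\<lambda>u. c * (of_nat m * u $ j * (a + w $ j) ^ (m - 1)))) (at w)"
proof -
  have "((\<lambda>w :: complex ^ 'n. a + w $ j) has_derivative (\<lambda>u. 0 + u $ j)) (at w)"
    by (intro has_derivative_add has_derivative_const has_derivative_vec_nth)
  hence "((\<lambda>w :: complex ^ 'n. a + w $ j) has_derivative (\<lambda>u. u $ j)) (at w)" by simp
  thus ?thesis by (intro has_derivative_mult_right has_derivative_power)
qed

lemma linear_complexI:
  fixes f :: "complex ^ 'n \<Rightarrow> complex ^ 'm"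
  assumes "\<And>x y. f (x + y) = f x + f y" and "\<And>c x. f (c *s x) = c *s f x"
  shows "Vector_Spaces.linear (*s) (*s) f"
  unfolding Vector_Spaces.linear_iff
  by (intro conjI allI assms vec.vector_space_axioms)

text \<open>Around a point \<open>p\<close> with \<open>p $ i \<noteq> 0\<close> the equation
  \<open>diag_poly k lam z = diag_poly k lam p + c\<close> can be solved for \<open>z $ i\<close> explicitly by a \<open>k\<close>-th
  root. In the resulting chart the coordinate \<open>w $ i\<close> is the increment of the polynomial, and
  the other coordinates are those of \<open>z - p\<close>. An explicit formula gives the second
  derivatives by the usual rules, which an abstract implicit function would not.\<close>

locale fibre_point =
  fixes lam p :: "complex ^ 'n" and k :: nat and i :: 'n
  assumes lam_i: "lam $ i \<noteq> 0" and p_i: "p $ i \<noteq> 0" and k_gt_2: "k > 2"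
begin

text \<open>The quotient of the required value of \<open>(z $ i) ^ k\<close> by \<open>(p $ i) ^ k\<close>. It is 1 at the centre,
  so that its principal \<open>k\<close>-th root is holomorphic where its real part is positive.\<close>

definition radicand :: "complex ^ 'n \<Rightarrow> complex" where
  "radicand w = (diag_poly k lam p + w $ i - (\<Sum>j\<in>-{i}. lam $ j * (p $ j + w $ j) ^ k))
                  / (lam $ i * (p $ i) ^ k)"

definition branch :: "complex ^ 'n \<Rightarrow> complex" where
  "branch w = p $ i * exp (Ln (radicand w) / of_nat k)"

definition chart_domain :: "(complex ^ 'n) set" where
  "chart_domain = {w. Re (radicand w) > 0}"

definition chart :: "complex ^ 'n \<Rightarrow> complex ^ 'n" where
  "chart w = (\<chi> j. if j = i then branch w else p $ j + w $ j)"

definition straighten :: "complex ^ 'n \<Rightarrow> complex ^ 'n" where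
  "straighten z = (\<chi> j. if j = i then diag_poly k lam z - diag_poly k lam p else z $ j - p $ j)"

text \<open>Up to the constant factor \<open>lam $ i * (p $ i) ^ k\<close>, the derivative of \<open>radicand\<close> at \<open>w\<close>.\<close>

definition numerator :: "complex ^ 'n \<Rightarrow> complex ^ 'n \<Rightarrow> complex" where
  "numerator w u = u $ i - (\<Sum>j\<in>-{i}. lam $ j * (of_nat k * u $ j * (p $ j + w $ j) ^ (k - 1)))"

definition dchart :: "complex ^ 'n \<Rightarrow> complex ^ 'n \<Rightarrow> complex ^ 'n" where
  "dchart w u = (\<chi> j. if j = i then numerator w u / (of_nat k * lam $ i * branch w ^ (k - 1))
                       else u $ j)"

lemma radicand_0: "radicand 0 = 1"
  using lam_i p_i unfolding radicand_def by (simp add: diag_poly_split[of _ _ _ i])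

lemma zero_in_chart_domain: "0 \<in> chart_domain"
  by (simp add: chart_domain_def radicand_0)

lemma branch_nonzero: "branch w \<noteq> 0"
  using p_i by (simp add: branch_def)

lemma branch_0: "branch 0 = p $ i"
  by (simp add: branch_def radicand_0)

lemma chart_0: "chart 0 = p"
  by (simp add: chart_def branch_0 vec_eq_iff)

lemma chart_nonzero: "chart w \<noteq> 0"
  using branch_nonzero[of w] by (auto simp: chart_def vec_eq_iff)

lemma branch_power:
  assumes "w \<in> chart_domain"
  shows "branch w ^ k = (p $ i) ^ k * radicand w"
proof -
  have "radicand w \<noteq> 0" using assms by (auto simp: chart_domain_def)
  moreover have "exp (Ln (radicand w) / of_nat k) ^ k = exp (Ln (radicand w))"
    using k_gt_2 by (simp flip: exp_of_nat_mult)
  ultimately show ?thesis by (simp add: branch_def power_mult_distrib)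
qed

lemma diag_poly_chart:
  assumes "w \<in> chart_domain"
  shows "diag_poly k lam (chart w) = diag_poly k lam p + w $ i"
proof -
  have "diag_poly k lam (chart w)
      = lam $ i * branch w ^ k + (\<Sum>j\<in>-{i}. lam $ j * (p $ j + w $ j) ^ k)"
    by (simp add: diag_poly_split[of _ _ _ i] chart_def)
  moreover have "lam $ i * ((p $ i) ^ k * radicand w)
      = diag_poly k lam p + w $ i - (\<Sum>j\<in>-{i}. lam $ j * (p $ j + w $ j) ^ k)"
    using lam_i p_i by (simp add: radicand_def)
  ultimately show ?thesis by (simp only: branch_power[OF assms]) simp
qed

lemma straighten_chart: "w \<in> chart_domain \<Longrightarrow> straighten (chart w) = w"
  by (simp add: straighten_def diag_poly_chart vec_eq_iff) (simp add: chart_def)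

lemma has_derivative_radicand:
  "(radicand has_derivative (\<lambda>u. numerator w u / (lam $ i * (p $ i) ^ k))) (at w)"
proof -
  have "((\<lambda>w. diag_poly k lam p + w $ i - (\<Sum>j\<in>-{i}. lam $ j * (p $ j + w $ j) ^ k))
         has_derivative (\<lambda>u. 0 + u $ i
           - (\<Sum>j\<in>-{i}. lam $ j * (of_nat k * u $ j * (p $ j + w $ j) ^ (k - 1))))) (at w)"
    by (intro has_derivative_diff has_derivative_add has_derivative_const has_derivative_vec_nth
        has_derivative_sum has_derivative_affine_power)
  from has_derivative_mult_left[OF this, of "inverse (lam $ i * (p $ i) ^ k)"]
  show ?thesis
    by (simp add: radicand_def[abs_def] numerator_def divide_inverse)
qed

lemma open_chart_domain: "open chart_domain"
proof -
  have "continuous_on UNIV radicand"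
    by (rule has_derivative_continuous_on, rule has_derivative_at_withinI,
        rule has_derivative_radicand)
  thus ?thesis unfolding chart_domain_def
    by (intro open_Collect_less continuous_intros)
qed

text \<open>The formula is the one given by implicit differentiation of
  \<open>lam $ i * branch w ^ k = lam $ i * (p $ i) ^ k * radicand w\<close>. In this form it can be
  differentiated once more without meeting the logarithm again.\<close>

lemma has_derivative_branch:
  assumes w: "w \<in> chart_domain"
  shows "(branch has_derivative
           (\<lambda>u. numerator w u / (of_nat k * lam $ i * branch w ^ (k - 1)))) (at w)"
proof -
  define R where "R = radicand w"
  have R: "R \<notin> \<real>\<^sub>\<le>\<^sub>0" "R \<noteq> 0"
    using w by (auto simp: chart_domain_def R_def complex_nonpos_Reals_iff)
  have "((\<lambda>x. p $ i * exp (Ln x / of_nat k)) has_field_derivative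
          p $ i * (exp (Ln R / of_nat k) * (inverse R / of_nat k))) (at R)"
    by (intro DERIV_cmult DERIV_fun_exp DERIV_cdivide has_field_derivative_Ln R)
  hence "((\<lambda>x. p $ i * exp (Ln x / of_nat k)) has_derivative
          (*) (p $ i * (exp (Ln R / of_nat k) * (inverse R / of_nat k)))) (at R)"
    by (simp only: has_field_derivative_def)
  from has_derivative_compose[OF has_derivative_radicand this[unfolded R_def]]
  have "(branch has_derivative (\<lambda>u. branch w * (inverse R / of_nat k)
           * (numerator w u / (lam $ i * (p $ i) ^ k)))) (at w)"
    by (simp add: branch_def[abs_def] R_def mult.assoc)
  moreover have "branch w * (inverse R / of_nat k) * (x / (lam $ i * (p $ i) ^ k))
      = x / (of_nat k * lam $ i * branch w ^ (k - 1))" for x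
  proof -
    have "branch w * branch w ^ (k - 1) = branch w ^ k"
      using k_gt_2 by (simp flip: power_Suc)
    hence "branch w * branch w ^ (k - 1) = (p $ i) ^ k * R"
      by (simp add: branch_power[OF w] R_def)
    thus ?thesis
      using R(2) lam_i p_i k_gt_2 branch_nonzero[of w] by (simp add: field_simps)
  qed
  ultimately show ?thesis by simp
qed

lemma has_derivative_chart:
  assumes "w \<in> chart_domain"
  shows "(chart has_derivative dchart w) (at w)"
proof (rule has_derivative_componentwiseI)
  fix j
  show "((\<lambda>w. chart w $ j) has_derivative (\<lambda>u. dchart w u $ j)) (at w)"
  proof (cases "j = i")
    case True
    thus ?thesis using has_derivative_branch[OF assms] by (simp add: chart_def dchart_def)
  next
    case False
    have "((\<lambda>w :: complex ^ 'n. p $ j + w $ j) has_derivative (\<lambda>u. 0 + u $ j)) (at w)"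
      by (intro has_derivative_add has_derivative_const has_derivative_vec_nth)
    thus ?thesis using False by (simp add: chart_def dchart_def)
  qed
qed

lemma linear_dchart: "Vector_Spaces.linear (*s) (*s) (dchart w)"
proof (rule linear_complexI)
  show "dchart w (x + y) = dchart w x + dchart w y" for x y
    by (simp add: dchart_def numerator_def vec_eq_iff sum.distrib add_divide_distrib
        diff_divide_distrib algebra_simps)
  show "dchart w (c *s x) = c *s dchart w x" for c x
    by (simp add: dchart_def numerator_def vec_eq_iff sum_distrib_left
        diff_divide_distrib algebra_simps)
qed

lemma has_derivative_straighten:
  "(straighten has_derivative
     (\<lambda>u. \<chi> j. if j = i then of_nat k * diag_form k lam z u else u $ j)) (at z)"
proof (rule has_derivative_componentwiseI)
  fix j
  have "((\<lambda>z. diag_poly k lam z - diag_poly k lam p) has_derivative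
          (\<lambda>u. of_nat k * diag_form k lam z u - 0)) (at z)"
    by (intro has_derivative_diff has_derivative_const has_derivative_diag_poly)
  moreover have "((\<lambda>z :: complex ^ 'n. z $ j - p $ j) has_derivative (\<lambda>u. u $ j - 0)) (at z)"
    by (intro has_derivative_diff has_derivative_const has_derivative_vec_nth)
  ultimately show "((\<lambda>z. straighten z $ j) has_derivative
      (\<lambda>u. (\<chi> j. if j = i then of_nat k * diag_form k lam z u else u $ j) $ j)) (at z)"
    by (cases "j = i") (simp_all add: straighten_def)
qed

lemma linear_straighten_derivative:
  "Vector_Spaces.linear (*s) (*s)
     (\<lambda>u. \<chi> j. if j = i then of_nat k * diag_form k lam z u else u $ j)"
  by (rule linear_complexI)
     (simp_all add: vec_eq_iff diag_form_scale diag_form_def sum.distrib ring_distribs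
        sum_distrib_left mult_ac)

text \<open>A leaf is a component of a punctured fibre, hence contains the plaque through \<open>p\<close>, which avoids
  the origin and is connected as the image of a convex set. Conversely, points of the leaf have the same value of the
  polynomial as \<open>p\<close>, so they lie on the slice \<open>w $ i = 0\<close>: one plaque suffices. Openness of the
  image is invariance of domain, and the inverse is the polynomial map \<open>straighten\<close>.\<close>

lemma leaf_chart_chart:
  assumes r: "r > 0" "ball 0 r \<subseteq> chart_domain"
    and L: "L \<in> components ({z. diag_poly k lam z = c} - {0})" "p \<in> L"
  shows "leaf_chart L p i (ball 0 r) chart"
proof -
  define W where "W = (ball 0 r :: (complex ^ 'n) set)"
  have W: "W \<subseteq> chart_domain" "0 \<in> W" "open W" using r by (auto simp: W_def)
  have c: "diag_poly k lam z = c" if "z \<in> L" for z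
    using in_components_subset[OF L(1)] that by auto
  have inj: "inj_on chart W"
    using straighten_chart W(1) by (metis inj_on_inverseI subsetD)
  have deriv: "(chart has_derivative dchart w) (at w)" if "w \<in> W" for w
    using has_derivative_chart W(1) that by blast
  have cont: "continuous_on W chart"
    by (rule has_derivative_continuous_on, rule has_derivative_at_withinI, rule deriv)
  have open_im: "open (chart ` W)"
    by (rule invariance_of_domain[OF cont W(3) inj])
  have inv: "inv_into W chart z = straighten z" if z: "z \<in> chart ` W" for z
  proof -
    obtain w where "w \<in> W" "z = chart w" using z by auto
    thus ?thesis using inv_into_f_f[OF inj] straighten_chart W(1) by auto
  qed
  have hol_inv: "holomorphic_map_on (inv_into W chart) (chart ` W)"
    unfolding holomorphic_map_on_def
  proof
    fix z assume z: "z \<in> chart ` W"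
    have "(inv_into W chart has_derivative
            (\<lambda>u. \<chi> j. if j = i then of_nat k * diag_form k lam z u else u $ j)) (at z)"
      by (rule has_derivative_transform_within_open[OF has_derivative_straighten open_im z])
         (simp add: inv)
    thus "\<exists>D. (inv_into W chart has_derivative D) (at z) \<and> Vector_Spaces.linear (*s) (*s) D"
      using linear_straighten_derivative by blast
  qed
  define S where "S = {w \<in> W. w $ i \<in> {0}}"
  have "convex {w :: complex ^ 'n. w $ i = 0}"
    by (rule convexI) simp
  hence "convex (W \<inter> {w. w $ i = 0})"
    by (simp add: W_def convex_Int)
  moreover have "S = W \<inter> {w. w $ i = 0}" by (auto simp: S_def)
  ultimately have "connected S" by (simp add: convex_connected)
  hence conn: "connected (chart ` S)"
    by (rule connected_continuous_image[rotated])
       (rule continuous_on_subset[OF cont], auto simp: S_def)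
  have sub: "chart ` S \<subseteq> {z. diag_poly k lam z = c} - {0}"
    using diag_poly_chart W(1) c[OF L(2)] chart_nonzero by (auto simp: S_def)
  have "p \<in> L \<inter> chart ` S"
    using W(2) chart_0 L(2) by (force simp: S_def)
  hence "chart ` S \<subseteq> L"
    using components_maximal[OF L(1) conn sub] by blast
  moreover have "z \<in> chart ` S" if z: "z \<in> L" "z \<in> chart ` W" for z
  proof -
    obtain w where w: "w \<in> W" "z = chart w" using z(2) by auto
    have "w $ i = 0"
      using diag_poly_chart[of w] w W(1) c[OF z(1)] c[OF L(2)] by auto
    thus ?thesis using w by (auto simp: S_def)
  qed
  ultimately have "L \<inter> chart ` W = chart ` S" by (auto simp: S_def)
  hence plaque: "\<exists>C. countable C \<and> 0 \<in> C \<and> L \<inter> chart ` W = chart ` {w \<in> W. w $ i \<in> C}"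
    unfolding S_def by (intro exI[of _ "{0}"]) simp
  have "holomorphic_map_on chart W"
    unfolding holomorphic_map_on_def using deriv linear_dchart by blast
  thus ?thesis
    unfolding leaf_chart_def
    using W inj open_im hol_inv plaque chart_0 by (simp add: W_def)
qed

lemma ball_in_chart_domain: obtains r where "r > 0" "ball 0 r \<subseteq> chart_domain"
  using open_chart_domain zero_in_chart_domain open_contains_ball by blast

lemma diag_form_dchart_0: "diag_form k lam p (dchart 0 u) = u $ i / of_nat k"
proof -
  have "lam $ i * (p $ i) ^ (k - 1) * dchart 0 u $ i = numerator 0 u / of_nat k"
    using lam_i p_i k_gt_2 by (simp add: dchart_def branch_0)
  moreover have "(\<Sum>j\<in>-{i}. lam $ j * (p $ j) ^ (k - 1) * dchart 0 u $ j)
      = (\<Sum>j\<in>-{i}. lam $ j * (of_nat k * u $ j * (p $ j + 0 $ j) ^ (k - 1))) / of_nat k"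
    unfolding sum_divide_distrib
    using k_gt_2 by (intro sum.cong) (auto simp: dchart_def)
  ultimately show ?thesis
    by (simp only: diag_form_split[of _ _ _ _ i] numerator_def) (simp add: diff_divide_distrib)
qed

text \<open>The tangent directions of the slice reach the whole kernel because the coordinate \<open>i\<close> of a
  vector in the kernel is determined by the others.\<close>

lemma kernel_in_dchart_image:
  assumes "diag_form k lam p U = 0"
  obtains u where "u $ i = 0" "dchart 0 u = U"
proof
  define u where "u = (\<chi> j. if j = i then 0 else U $ j)"
  show "u $ i = 0" by (simp add: u_def)
  have eq: "dchart 0 u $ j = U $ j" if "j \<noteq> i" for j
    using that by (simp add: dchart_def u_def)
  have "diag_form k lam p (dchart 0 u) = diag_form k lam p U"
    using assms by (simp add: diag_form_dchart_0 u_def)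
  hence "dchart 0 u $ i = U $ i"
    using lam_i p_i eq by (simp add: diag_form_split[of _ _ _ _ i])
  thus "dchart 0 u = U" using eq by (metis vec_eq_iff)
qed

end

section \<open>The Hessian on a leaf\<close>

context fibre_point begin

text \<open>The second derivative of \<open>branch\<close> at the centre. Differentiating
  \<open>lam $ i * branch w ^ k + (\<Sum>j\<in>-{i}. lam $ j * (p $ j + w $ j) ^ k) = diag_poly k lam p + w $ i\<close>
  twice shows that \<open>k * lam $ i * (p $ i) ^ (k - 1)\<close> times it cancels the second derivative of
  the polynomial at \<open>p\<close> along \<open>dchart 0 u\<close> and \<open>dchart 0 v\<close>, which is \<open>k * (k - 1)\<close> times the sum
  over \<open>j\<close> below.\<close>

definition branch_second :: "complex ^ 'n \<Rightarrow> complex ^ 'n \<Rightarrow> complex" where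
  "branch_second u v = - of_nat (k - 1) / (lam $ i * (p $ i) ^ (k - 1))
     * (\<Sum>j\<in>UNIV. lam $ j * (p $ j) ^ (k - 2) * (dchart 0 u $ j * dchart 0 v $ j))"

text \<open>Only the coordinate \<open>i\<close> of the chart is not affine, so it alone contributes a second
  derivative next to the inner product of the first derivatives.\<close>

definition hess :: "complex ^ 'n \<Rightarrow> complex ^ 'n \<Rightarrow> real" where
  "hess u v = 2 * (dchart 0 u \<bullet> dchart 0 v + Re (cnj (p $ i) * branch_second u v))"

lemma has_derivative_dchart:
  "((\<lambda>y. dchart y u) has_derivative (\<lambda>v. axis i (branch_second u v))) (at 0)"
proof (rule has_derivative_componentwiseI)
  fix j
  show "((\<lambda>y. dchart y u $ j) has_derivative (\<lambda>v. axis i (branch_second u v) $ j)) (at 0)"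
  proof (cases "j = i")
    case False
    thus ?thesis by (simp add: dchart_def axis_def)
  next
    case True
    define g where "g y = of_nat k * lam $ i * branch y ^ (k - 1)" for y
    define g' where "g' v = of_nat k * lam $ i
        * (of_nat (k - 1) * dchart 0 v $ i * branch 0 ^ (k - 1 - 1))" for v
    define N' where "N' v = - (\<Sum>j\<in>-{i}. (lam $ j * (of_nat k * u $ j))
        * (of_nat (k - 1) * v $ j * (p $ j + 0 $ j) ^ (k - 1 - 1)))" for v :: "complex ^ 'n"
    have "(branch has_derivative (\<lambda>v. dchart 0 v $ i)) (at 0)"
      using has_derivative_branch[OF zero_in_chart_domain] by (simp add: dchart_def)
    hence g: "(g has_derivative g') (at 0)"
      unfolding g_def[abs_def] g'_def[abs_def]
      by (intro has_derivative_mult_right has_derivative_power)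
    have "((\<lambda>y. u $ i - (\<Sum>j\<in>-{i}. (lam $ j * (of_nat k * u $ j)) * (p $ j + y $ j) ^ (k - 1)))
           has_derivative (\<lambda>v. 0 - (\<Sum>j\<in>-{i}. (lam $ j * (of_nat k * u $ j))
              * (of_nat (k - 1) * v $ j * (p $ j + 0 $ j) ^ (k - 1 - 1))))) (at 0)"
      by (intro has_derivative_diff has_derivative_const has_derivative_sum
          has_derivative_affine_power)
    hence N: "((\<lambda>y. numerator y u) has_derivative N') (at 0)"
      by (simp add: numerator_def N'_def[abs_def] mult.assoc)
    have g0: "g 0 = of_nat k * lam $ i * (p $ i) ^ (k - 1)" by (simp add: g_def branch_0)
    have gnz: "g 0 \<noteq> 0" using lam_i p_i k_gt_2 by (simp add: g0)
    have Ui: "dchart 0 u $ i = numerator 0 u / g 0" by (simp add: dchart_def g_def)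
    have "((\<lambda>y. numerator y u / g y) has_derivative
           (\<lambda>v. (N' v * g 0 - numerator 0 u * g' v) / (g 0 * g 0))) (at 0)"
      by (rule has_derivative_divide'[OF N g gnz])
    moreover have "(N' v * g 0 - numerator 0 u * g' v) / (g 0 * g 0) = branch_second u v" for v
    proof -
      define X where "X = (\<Sum>j\<in>-{i}. lam $ j * (p $ j) ^ (k - 2) * (u $ j * v $ j))"
      define Y where "Y = lam $ i * (p $ i) ^ (k - 2) * (dchart 0 u $ i * dchart 0 v $ i)"
      have "(\<Sum>j\<in>UNIV. lam $ j * (p $ j) ^ (k - 2) * (dchart 0 u $ j * dchart 0 v $ j))
          = Y + (\<Sum>j\<in>-{i}. lam $ j * (p $ j) ^ (k - 2) * (dchart 0 u $ j * dchart 0 v $ j))"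
        unfolding Y_def Compl_eq_Diff_UNIV by (rule sum.remove) auto
      also have "(\<Sum>j\<in>-{i}. lam $ j * (p $ j) ^ (k - 2) * (dchart 0 u $ j * dchart 0 v $ j)) = X"
        unfolding X_def by (intro sum.cong) (auto simp: dchart_def)
      finally have sum: "(\<Sum>j\<in>UNIV. lam $ j * (p $ j) ^ (k - 2)
          * (dchart 0 u $ j * dchart 0 v $ j)) = Y + X" .
      have k2: "k - 1 - 1 = k - 2" by simp
      have "N' v = - (of_nat k * of_nat (k - 1) * X)"
        unfolding N'_def X_def k2 by (simp add: sum_distrib_left mult_ac)
      moreover have "dchart 0 u $ i * g' v = of_nat k * of_nat (k - 1) * Y"
        unfolding g'_def Y_def k2 branch_0 by (simp add: mult_ac)
      moreover have "(N' v * g 0 - numerator 0 u * g' v) / (g 0 * g 0)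
          = (N' v - dchart 0 u $ i * g' v) / g 0"
        using gnz by (simp add: Ui field_simps)
      ultimately have "(N' v * g 0 - numerator 0 u * g' v) / (g 0 * g 0)
          = - (of_nat k * of_nat (k - 1) * (Y + X)) / g 0"
        by (simp add: ring_distribs)
      also have "\<dots> = branch_second u v"
        using k_gt_2 unfolding branch_second_def sum g0 by (simp del: of_nat_diff)
      finally show ?thesis .
    qed
    ultimately show ?thesis using True by (simp add: dchart_def g_def)
  qed
qed

lemma has_hessian_quad_form_chart: "has_hessian (quad_form \<circ> chart) hess 0"
proof -
  define q' where "q' y u = 2 * (chart y \<bullet> dchart y u)" for y u
  have "((quad_form \<circ> chart) has_derivative q' y) (at y)" if "y \<in> chart_domain" for y
  proof -
    have "((\<lambda>w. quad_form (chart w)) has_derivative (\<lambda>u. 2 * (chart y \<bullet> dchart y u))) (at y)"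
      by (rule has_derivative_compose[OF has_derivative_chart[OF that] has_derivative_quad_form])
    thus ?thesis by (simp add: o_def q'_def[abs_def])
  qed
  hence "\<forall>\<^sub>F y in nhds 0. ((quad_form \<circ> chart) has_derivative q' y) (at y)"
    using open_chart_domain zero_in_chart_domain unfolding eventually_nhds by blast
  moreover have "((\<lambda>y. q' y u) has_derivative hess u) (at 0)" for u
  proof -
    have "((\<lambda>y. q' y u) has_derivative
            (\<lambda>v. 2 * (chart 0 \<bullet> axis i (branch_second u v) + dchart 0 v \<bullet> dchart 0 u))) (at 0)"
      unfolding q'_def
      by (intro has_derivative_mult_right has_derivative_inner has_derivative_dchart
          has_derivative_chart zero_in_chart_domain)
    moreover have "p \<bullet> axis i b = Re (cnj (p $ i) * b)" for b
      by (simp add: inner_axis inner_complex_def)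
    ultimately show ?thesis
      by (simp add: hess_def[abs_def] chart_0 inner_commute add.commute)
  qed
  ultimately show ?thesis unfolding has_hessian_def by blast
qed

lemma critical_in_chart_chart:
  assumes "\<And>u. diag_form k lam p u = 0 \<Longrightarrow> p \<bullet> u = 0"
  shows "critical_in_chart quad_form i chart"
proof -
  have "((\<lambda>w. quad_form (chart w)) has_derivative (\<lambda>u. 2 * (chart 0 \<bullet> dchart 0 u))) (at 0)"
    by (rule has_derivative_compose[OF has_derivative_chart[OF zero_in_chart_domain] has_derivative_quad_form])
  thus ?thesis unfolding critical_in_chart_def o_def
    using assms by (intro exI conjI) (auto simp: chart_0 diag_form_dchart_0)
qed

text \<open>Write \<open>U\<close> and \<open>V\<close> for the images of \<open>u\<close> and \<open>v\<close> under \<open>dchart 0\<close>. By the multiplier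
  equation, half of the Hessian is the real part of
  \<open>\<Sum>j. (cnj (U $ j) - (k - 1) * \<mu> * lam $ j * (p $ j) ^ (k - 2) * U $ j) * V $ j\<close>. If it vanishes
  for all \<open>V\<close> in the kernel of the differential, its coefficients are proportional to those
  of the differential.

  Where \<open>p $ j = 0\<close> this says \<open>U $ j = 0\<close>, because \<open>k > 2\<close>. Elsewhere put \<open>U $ j = t j * p $ j\<close>
  and divide by \<open>cnj (p $ j)\<close>: the number \<open>cnj (t j) - (k - 1) * t j\<close> does not depend on \<open>j\<close>.
  Conjugation preserves the absolute value and \<open>k - 1 > 1\<close>, so the real linear map
  \<open>t \<mapsto> cnj t - (k - 1) * t\<close> is injective, and \<open>U\<close> is a complex multiple of \<open>p\<close>. But \<open>U\<close> lies in
  the kernel, which at a critical point is the Hermitian orthogonal complement of \<open>p\<close>;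
  hence \<open>U = 0\<close>.\<close>

lemma nondegenerate_in_chart_chart:
  assumes "critical_eq k lam p"
  shows "nondegenerate_in_chart quad_form i chart"
proof -
  obtain \<mu> where \<mu>: "cnj (p $ j) = \<mu> * (lam $ j * (p $ j) ^ (k - 1))" for j
    using assms by (auto simp: critical_eq_def)
  define m where "m = (of_nat (k - 1) :: complex)"
  have \<mu>0: "\<mu> \<noteq> 0" using \<mu>[of i] p_i by auto
  have "u = 0" if u: "u $ i = 0" and ker: "\<And>v. v $ i = 0 \<Longrightarrow> hess u v = 0" for u
  proof -
    define U where "U = dchart 0 u"
    have U: "diag_form k lam p U = 0" using u by (simp add: U_def diag_form_dchart_0)
    define a where "a = (\<chi> j. cnj (U $ j) - m * \<mu> * lam $ j * (p $ j) ^ (k - 2) * U $ j)"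
    define b where "b = (\<chi> j. lam $ j * (p $ j) ^ (k - 1))"
    define \<rho> where "\<rho> = a $ i / b $ i"
    have prop_ab: "a $ j = \<rho> * b $ j" for j
      unfolding \<rho>_def
    proof (rule proportional_if_Re_vanishes_on_kernel)
      show "b $ i \<noteq> 0" using lam_i p_i by (simp add: b_def)
      fix V assume "(\<Sum>j\<in>UNIV. b $ j * V $ j) = 0"
      hence "diag_form k lam p V = 0" by (simp add: diag_form_def b_def)
      then obtain v where v: "v $ i = 0" "dchart 0 v = V" by (rule kernel_in_dchart_image)
      have "cnj (p $ i) * branch_second u v
          = - m * \<mu> * (\<Sum>j\<in>UNIV. lam $ j * (p $ j) ^ (k - 2) * (U $ j * V $ j))"
        using lam_i p_i unfolding branch_second_def v U_def[symmetric] \<mu>[of i] m_def by simp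
      hence "hess u v = 2 * Re ((\<Sum>j\<in>UNIV. cnj (U $ j) * V $ j)
          - m * \<mu> * (\<Sum>j\<in>UNIV. lam $ j * (p $ j) ^ (k - 2) * (U $ j * V $ j)))"
        unfolding hess_def v U_def[symmetric] inner_eq_Re_sum by simp
      also have "(\<Sum>j\<in>UNIV. cnj (U $ j) * V $ j)
          - m * \<mu> * (\<Sum>j\<in>UNIV. lam $ j * (p $ j) ^ (k - 2) * (U $ j * V $ j))
          = (\<Sum>j\<in>UNIV. a $ j * V $ j)"
        unfolding sum_distrib_left sum_subtractf[symmetric]
        by (intro sum.cong) (simp_all add: a_def algebra_simps)
      finally show "Re (\<Sum>j\<in>UNIV. a $ j * V $ j) = 0" using ker[OF v(1)] by simp
    qed
    have pow: "(p $ j) ^ (k - 1) = p $ j * (p $ j) ^ (k - 2)" for j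
      using k_gt_2 by (simp add: Suc_diff_Suc numeral_2_eq_2 flip: power_Suc)
    define t where "t j = U $ j / p $ j" for j
    have t: "cnj (t j) - m * t j = \<rho> / \<mu>" if "p $ j \<noteq> 0" for j
    proof -
      have U_t: "U $ j = t j * p $ j" using that by (simp add: t_def)
      have "cnj (p $ j) * (cnj (t j) - m * t j)
          = cnj (t j) * cnj (p $ j) - m * t j * (\<mu> * (lam $ j * (p $ j) ^ (k - 1)))"
        by (simp only: \<mu>[of j, symmetric]) (simp add: algebra_simps)
      also have "\<dots> = a $ j" unfolding a_def vec_lambda_beta U_t pow by (simp add: algebra_simps)
      also have "\<dots> = \<rho> / \<mu> * cnj (p $ j)"
        unfolding prop_ab using \<mu>0 by (simp add: \<mu> b_def)
      finally show ?thesis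
        using that by (metis complex_cnj_zero_iff mult.commute mult_left_cancel)
    qed
    have t_const: "t j = t i" if "p $ j \<noteq> 0" for j
    proof -
      define d where "d = t j - t i"
      have "cnj d = m * d"
        using t[OF that] t[OF p_i] by (simp add: d_def algebra_simps)
      hence "cmod d = real (k - 1) * cmod d"
        by (metis complex_mod_cnj m_def norm_mult norm_of_nat)
      hence "d = 0" using k_gt_2 by auto
      thus ?thesis by (simp add: d_def)
    qed
    have U_p: "U $ j = t i * p $ j" for j
    proof (cases "p $ j = 0")
      case False
      thus ?thesis using t_const[OF False] by (simp add: t_def field_simps)
    next
      case True
      hence "cnj (U $ j) = 0"
        using prop_ab[of j] k_gt_2 by (simp add: a_def b_def power_0_left)
      thus ?thesis using True by simp
    qed
    have "0 = \<mu> * diag_form k lam p U" by (simp add: U)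
    also have "\<dots> = t i * (\<Sum>j\<in>UNIV. cnj (p $ j) * p $ j)"
      unfolding \<mu> by (simp add: diag_form_def U_p sum_distrib_left mult_ac)
    finally have "t i * (\<Sum>j\<in>UNIV. cnj (p $ j) * p $ j) = 0" by simp
    moreover have "Re (\<Sum>j\<in>UNIV. cnj (p $ j) * p $ j) \<noteq> 0"
      using p_i inner_eq_Re_sum[of p p] by (auto simp del: Re_sum)
    ultimately have "t i = 0" by (metis mult_eq_0_iff zero_complex.sel(1))
    hence "U = 0" by (simp add: vec_eq_iff U_p)
    hence "u $ j = 0" if "j \<noteq> i" for j
      using that unfolding U_def by (simp add: vec_eq_iff dchart_def) metis
    thus "u = 0" using u by (metis vec_eq_iff zero_index)
  qed
  thus ?thesis unfolding nondegenerate_in_chart_def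
    using has_hessian_quad_form_chart by blast
qed

lemma tangent_space_leaf:
  assumes L: "L \<in> components ({z. diag_poly k lam z = c} - {0})" "p \<in> L"
  shows "tangent_space L p = {v. diag_form k lam p v = 0}"
proof (intro equalityI subsetI)
  fix v assume v: "v \<in> tangent_space L p"
  have "diag_form k lam p v = 0"
    by (rule tangent_space_fibre_subset[OF _ _ v, where c = c])
       (use in_components_subset[OF L(1)] k_gt_2 in auto)
  thus "v \<in> {v. diag_form k lam p v = 0}" by simp
next
  fix v assume "v \<in> {v. diag_form k lam p v = 0}"
  then obtain u where u: "u $ i = 0" "dchart 0 u = v"
    by (auto elim: kernel_in_dchart_image)
  obtain r where "r > 0" "ball 0 r \<subseteq> chart_domain" by (rule ball_in_chart_domain)
  from leaf_chart_derivative_in_tangent_space[OF leaf_chart_chart[OF this L]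
      has_derivative_chart[OF zero_in_chart_domain] u(1)]
  show "v \<in> tangent_space L p" by (simp add: u(2))
qed

end

section \<open>Morse structure and polar variety\<close>

lemma fibre_foliationE:
  assumes "L \<in> fibre_foliation h"
  obtains c where "L \<in> components ({z. h z = c} - {0})" "L \<subseteq> {z. h z = c} - {0}"
  using assms in_components_subset unfolding fibre_foliation_def by blast

lemma ex_fibre_point:
  fixes lam :: "complex ^ 'n"
  assumes "\<And>i. lam $ i \<noteq> 0" and "k > 2" and "p \<noteq> 0"
  obtains i where "fibre_point lam p k i"
  using assms by (auto simp: vec_eq_iff fibre_point_def)

text \<open>A critical point may be witnessed by any chart, but the multiplier equation does not refer to
  the chart. So it transfers criticality to the explicit chart, in which the Hessian is known.\<close>

lemma morse_function_on_leaf: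
  fixes lam :: "complex ^ 'n"
  assumes lam: "\<And>i. lam $ i \<noteq> 0" and k: "k > 2"
    and "L \<in> fibre_foliation (diag_poly k lam)"
  shows "morse_function_on L quad_form"
proof -
  obtain c where L: "L \<in> components ({z. diag_poly k lam z = c} - {0})"
    "L \<subseteq> {z. diag_poly k lam z = c} - {0}"
    using assms(3) by (rule fibre_foliationE)
  have "\<exists>i W \<Phi>. leaf_chart L p i W \<Phi>
          \<and> (critical_eq k lam p \<longrightarrow> critical_in_chart quad_form i \<Phi> \<and> nondegenerate_in_chart quad_form i \<Phi>)"
    if p: "p \<in> L" for p
  proof -
    have p0: "p \<noteq> 0" using p L(2) by auto
    obtain i where "fibre_point lam p k i" using ex_fibre_point[OF lam k p0] .
    then interpret fibre_point lam p k i .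
    obtain r where r: "r > 0" "ball 0 r \<subseteq> chart_domain" by (rule ball_in_chart_domain)
    have "critical_in_chart quad_form i chart" if "critical_eq k lam p"
      using that critical_eq_iff_orthogonal[OF lam p0] by (intro critical_in_chart_chart) blast
    thus ?thesis
      using leaf_chart_chart[OF r L(1) p] nondegenerate_in_chart_chart by blast
  qed
  note charts = this
  have "nondegenerate_critical_point_on L quad_form p" if crit: "critical_point_on L quad_form p" for p
  proof -
    obtain i W \<Phi> where p: "p \<in> L" and "leaf_chart L p i W \<Phi>" "critical_in_chart quad_form i \<Phi>"
      using crit unfolding critical_point_on_def by blast
    hence "critical_eq k lam p"
      using critical_eq_if_critical_in_chart[OF lam _ L(2)] k by auto
    thus ?thesis
      using charts[OF p] p unfolding nondegenerate_critical_point_on_def by blast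
  qed
  thus ?thesis
    unfolding morse_function_on_def complex_hypersurface_def using charts by blast
qed

lemma polar_variety_eq:
  fixes lam :: "complex ^ 'n"
  assumes lam: "\<And>i. lam $ i \<noteq> 0" and k: "k > 2"
  shows "polar_variety (fibre_foliation (diag_poly k lam)) quad_form
       = {0} \<union> {z. z \<noteq> 0 \<and> critical_eq k lam z}"
proof -
  have tangent: "tangent_space L z \<subseteq> tangent_space {w. quad_form w = quad_form z} z
      \<longleftrightarrow> critical_eq k lam z"
    if z: "z \<noteq> 0" and leaf: "L \<in> fibre_foliation (diag_poly k lam)" "z \<in> L" for L z
  proof -
    obtain c where L: "L \<in> components ({z. diag_poly k lam z = c} - {0})"
      using leaf(1) by (rule fibre_foliationE)
    obtain i where "fibre_point lam z k i" using ex_fibre_point[OF lam k z] .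
    then interpret fibre_point lam z k i .
    show ?thesis
      using tangent_space_leaf[OF L leaf(2)] tangent_space_sphere[OF z]
        critical_eq_iff_orthogonal[OF lam z] by auto
  qed
  have leaf: "\<exists>L\<in>fibre_foliation (diag_poly k lam). z \<in> L" if "z \<noteq> 0" for z
  proof -
    have "z \<in> \<Union> (components ({w. diag_poly k lam w = diag_poly k lam z} - {0}))"
      using that by (simp only: Union_components) simp
    thus ?thesis unfolding fibre_foliation_def by blast
  qed
  have "(\<exists>L\<in>fibre_foliation (diag_poly k lam).
            z \<in> L \<and> tangent_space L z \<subseteq> tangent_space {w. quad_form w = quad_form z} z)
          \<longleftrightarrow> critical_eq k lam z" if "z \<noteq> 0" for z
    using leaf[OF that] tangent[OF that] by metis
  thus ?thesis unfolding polar_variety_def by (simp cong: conj_cong)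
qed

theorem theorem6p4:
  fixes lam :: "complex ^ 'n" and k :: nat
  assumes "CARD('n) \<ge> 2"
    and "\<And>i. lam $ i \<noteq> 0"
    and "k > 2"
  shows "has_morse_structure (fibre_foliation (diag_poly k lam)) quad_form \<and>
    (\<exists>A. finite A \<and> (\<forall>l\<in>A. complex_line_through_0 l) \<and>
         polar_variety (fibre_foliation (diag_poly k lam)) quad_form = \<Union>A)"
proof
  show "has_morse_structure (fibre_foliation (diag_poly k lam)) quad_form"
    unfolding has_morse_structure_def using morse_function_on_leaf[OF assms(2,3)] by blast
  show "\<exists>A. finite A \<and> (\<forall>l\<in>A. complex_line_through_0 l) \<and>
      polar_variety (fibre_foliation (diag_poly k lam)) quad_form = \<Union>A"
    unfolding polar_variety_eq[OF assms(2,3)]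
    by (rule critical_set_finite_union_of_lines[OF assms(2,3)])
qed

end
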